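(* Let $\beta,\lambda\in\mathbb{R}$. If the product manifold $\mathbb{R}^2\times\mathbb{H}^2$ of $(\mathbb{R}^2,g^R)$ and $(\mathbb{H}^2,g^H)$, where $g^R,g^H$ are the canonical metrics of constant scalar curvature $0,-2$ respectively, equipped with the product metric $g$, admits a gradient $\omega$-Bach soliton with potential function $\mathcal{F}=\mathcal{F}(s,t,x,y)$, then $$\mathcal{F}=\frac12\Big[\big(\lambda-\tfrac13\big)+\beta P_1^2\Big]s^2+\frac12\Big[\big(\lambda-\tfrac13\big)+\beta P_2^2\Big]t^2+\beta P_1P_2\,st+c_1s+c_3t-\big(\lambda+\tfrac13\big)\ln y-\frac12\beta P_3^2y^2+c,$$ where $c,c_1,c_3$ are arbitrary constants and $\omega(X)=g(X,P)$ with $P=P_1\frac{\partial}{\partial s}+P_2\frac{\partial}{\partial t}+P_3\frac{\partial}{\partial x}+P_4\frac{\partial}{\partial y}$, $P_i\in\mathbb{R}$ for all $i\in\{1,\dots,4\}$.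
   Context: $(s,t)$ are the standard coordinates on $\mathbb{R}^2$ with flat metric $g^R$, and $(x,y)$, $y>0$, are coordinates on the Poincaré upper half plane model of $\mathbb{H}^2$, in which $g^H=\frac{dx^2+dy^2}{y^2}$. For $\beta\in\mathbb{R}$ and a vector field $P$ with associated $1$-form $\omega(X)=g(X,P)$, the $\omega$-Bach tensor is $B_\omega=B-\beta\,\omega\otimes\omega$, where $B$ is the Bach tensor of $g$. The normalization of $B$ here is the following: for a product of two surfaces $(\Sigma_1,g_1)$, $(\Sigma_2,g_2)$ with constant scalar curvatures $r_1,r_2$, $B=-\frac1{12}(r_1^2-r_2^2)g_1$ on $\Sigma_1$, $B=-\frac{1}{12}(r_2^2-r_1^2)g_2$ on $\Sigma_2$, with zero mixed components; in particular on $\mathbb{R}^2\times\mathbb{H}^2$, $B=\frac13g^R$ on $\mathbb{R}^2$ and $B=-\frac13g^H$ on $\mathbb{H}^2$. A gradient $\omega$-Bach soliton with potential function $\mathcal{F}$ (and constant $\lambda\in\mathbb{R}$) is a Riemannian manifold with a smooth function $\mathcal{F}$ satisfying $\nabla_i\nabla_j\mathcal{F}+(B_\omega)_{ij}=\lambda g_{ij}$, with $\nabla_i\nabla_j\mathcal{F}$ the Hessian. *)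

theory Defs
  imports "HOL-Analysis.Analysis"
begin

text \<open>
  Riemannian geometry in one global chart: a manifold is an open set of points
  \<open>p :: real ^ 'n\<close> and a metric is given by its component matrix \<open>g p $ i $ j\<close> in the
  coordinate frame. A covariant tensor field is given by its components, indexed by a list of
  coordinate indices; only lists whose length is the rank of the tensor are meaningful.
\<close>

type_synonym 'n metric = "real ^ 'n \<Rightarrow> real ^ 'n ^ 'n"
type_synonym 'n tensor = "real ^ 'n \<Rightarrow> 'n list \<Rightarrow> real"

definition partial :: "'n::finite \<Rightarrow> (real ^ 'n \<Rightarrow> real) \<Rightarrow> real ^ 'n \<Rightarrow> real" where
  "partial i f p = frechet_derivative f (at p) (axis i 1)"

primrec C_k_on :: "nat \<Rightarrow> (real ^ 'n::finite) set \<Rightarrow> (real ^ 'n \<Rightarrow> real) \<Rightarrow> bool" where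
  "C_k_on 0 U f \<longleftrightarrow> continuous_on U f"
| "C_k_on (Suc k) U f \<longleftrightarrow> (\<forall>p\<in>U. f differentiable (at p)) \<and> (\<forall>i. C_k_on k U (partial i f))"

definition smooth_on :: "(real ^ 'n::finite) set \<Rightarrow> (real ^ 'n \<Rightarrow> real) \<Rightarrow> bool" where
  "smooth_on U f \<longleftrightarrow> (\<forall>k. C_k_on k U f)"

definition riemannian_metric_on :: "(real ^ 'n::finite) set \<Rightarrow> 'n metric \<Rightarrow> bool" where
  "riemannian_metric_on U g \<longleftrightarrow>
     (\<forall>i j. smooth_on U (\<lambda>p. g p $ i $ j)) \<and>
     (\<forall>p\<in>U. transpose (g p) = g p \<and> (\<forall>v. v \<noteq> 0 \<longrightarrow> 0 < v \<bullet> (g p *v v)))"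

definition inverse_metric :: "'n::finite metric \<Rightarrow> 'n metric" where
  "inverse_metric g p = matrix_inv (g p)"

definition christoffel :: "'n::finite metric \<Rightarrow> 'n \<Rightarrow> 'n \<Rightarrow> 'n \<Rightarrow> real ^ 'n \<Rightarrow> real" where
  \<comment> \<open>the upper index comes first\<close>
  "christoffel g k i j p = (\<Sum>l\<in>UNIV. inverse_metric g p $ k $ l *
     (partial i (\<lambda>q. g q $ j $ l) p + partial j (\<lambda>q. g q $ i $ l) p
      - partial l (\<lambda>q. g q $ i $ j) p)) / 2"

fun cov_deriv :: "'n::finite metric \<Rightarrow> 'n tensor \<Rightarrow> 'n tensor" where
  \<comment> \<open>the new, differentiating index comes first\<close>
  "cov_deriv g T p (a # is) = partial a (\<lambda>q. T q is) p
     - (\<Sum>m<length is. \<Sum>b\<in>UNIV. christoffel g b a (is ! m) p * T p (is[m := b]))"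
| "cov_deriv g T p [] = 0"

definition hessian :: "'n::finite metric \<Rightarrow> (real ^ 'n \<Rightarrow> real) \<Rightarrow> 'n tensor" where
  "hessian g f = cov_deriv g (cov_deriv g (\<lambda>p is. f p))"

definition riemann_up :: "'n::finite metric \<Rightarrow> 'n \<Rightarrow> 'n \<Rightarrow> 'n \<Rightarrow> 'n \<Rightarrow> real ^ 'n \<Rightarrow> real" where
  \<comment> \<open>the coefficient of \<open>\<partial>\<^sub>l\<close> in \<open>R(\<partial>\<^sub>i, \<partial>\<^sub>j) \<partial>\<^sub>k = (\<nabla>\<^sub>i \<nabla>\<^sub>j - \<nabla>\<^sub>j \<nabla>\<^sub>i) \<partial>\<^sub>k\<close>\<close>
  "riemann_up g l i j k p =
     partial i (christoffel g l j k) p - partial j (christoffel g l i k) p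
     + (\<Sum>m\<in>UNIV. christoffel g l i m p * christoffel g m j k p
                 - christoffel g l j m p * christoffel g m i k p)"

definition riemann :: "'n::finite metric \<Rightarrow> 'n \<Rightarrow> 'n \<Rightarrow> 'n \<Rightarrow> 'n \<Rightarrow> real ^ 'n \<Rightarrow> real" where
  \<comment> \<open>\<open>R\<^sub>i\<^sub>j\<^sub>k\<^sub>l = g(R(\<partial>\<^sub>i, \<partial>\<^sub>j) \<partial>\<^sub>l, \<partial>\<^sub>k)\<close>, so that \<open>R\<^sub>i\<^sub>j\<^sub>i\<^sub>j > 0\<close> on round spheres\<close>
  "riemann g i j k l p = (\<Sum>m\<in>UNIV. g p $ k $ m * riemann_up g m i j l p)"

definition ricci :: "'n::finite metric \<Rightarrow> 'n \<Rightarrow> 'n \<Rightarrow> real ^ 'n \<Rightarrow> real" where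
  "ricci g i k p = (\<Sum>j\<in>UNIV. \<Sum>l\<in>UNIV. inverse_metric g p $ j $ l * riemann g i j k l p)"

definition scalar_curvature :: "'n::finite metric \<Rightarrow> real ^ 'n \<Rightarrow> real" where
  "scalar_curvature g p = (\<Sum>i\<in>UNIV. \<Sum>k\<in>UNIV. inverse_metric g p $ i $ k * ricci g i k p)"

definition weyl :: "'n::finite metric \<Rightarrow> 'n \<Rightarrow> 'n \<Rightarrow> 'n \<Rightarrow> 'n \<Rightarrow> real ^ 'n \<Rightarrow> real" where
  "weyl g i j k l p = riemann g i j k l p
     - (g p $ i $ k * ricci g j l p - g p $ i $ l * ricci g j k p
        - g p $ j $ k * ricci g i l p + g p $ j $ l * ricci g i k p) / (real CARD('n) - 2)
     + scalar_curvature g p * (g p $ i $ k * g p $ j $ l - g p $ i $ l * g p $ j $ k)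
         / ((real CARD('n) - 1) * (real CARD('n) - 2))"

definition weyl_tensor :: "'n::finite metric \<Rightarrow> 'n tensor" where
  "weyl_tensor g p is = weyl g (is ! 0) (is ! 1) (is ! 2) (is ! 3) p"

text \<open>
  The Bach tensor, for dimension at least 4. The factor \<open>-2\<close> in front of the classical
  expression \<open>\<nabla>\<^sup>k \<nabla>\<^sup>l W\<^sub>i\<^sub>k\<^sub>j\<^sub>l / (n - 3) + R\<^sup>k\<^sup>l W\<^sub>i\<^sub>k\<^sub>j\<^sub>l / (n - 2)\<close> is the normalization
  for which a product of two surfaces with constant scalar curvatures \<open>r\<^sub>1, r\<^sub>2\<close> has
  \<open>B = - (r\<^sub>1\<^sup>2 - r\<^sub>2\<^sup>2) / 12 g\<^sub>1\<close> on the first factor and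
  \<open>B = - (r\<^sub>2\<^sup>2 - r\<^sub>1\<^sup>2) / 12 g\<^sub>2\<close> on the second.
\<close>

definition bach :: "'n::finite metric \<Rightarrow> 'n \<Rightarrow> 'n \<Rightarrow> real ^ 'n \<Rightarrow> real" where
  "bach g i j p = - 2 * (\<Sum>k\<in>UNIV. \<Sum>l\<in>UNIV. \<Sum>a\<in>UNIV. \<Sum>b\<in>UNIV.
     inverse_metric g p $ k $ a * inverse_metric g p $ l $ b *
       (cov_deriv g (cov_deriv g (weyl_tensor g)) p [a, b, i, k, j, l] / (real CARD('n) - 3)
        + ricci g a b p * weyl g i k j l p / (real CARD('n) - 2)))"

definition dual_form :: "'n::finite metric \<Rightarrow> (real ^ 'n \<Rightarrow> real ^ 'n) \<Rightarrow> real ^ 'n \<Rightarrow> real ^ 'n \<Rightarrow> real" where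
  \<comment> \<open>\<open>dual_form g P p X = g\<^sub>p(X, P\<^sub>p)\<close>\<close>
  "dual_form g P p X = X \<bullet> (g p *v P p)"

definition omega_bach ::
  "'n::finite metric \<Rightarrow> real \<Rightarrow> (real ^ 'n \<Rightarrow> real ^ 'n \<Rightarrow> real) \<Rightarrow> 'n \<Rightarrow> 'n \<Rightarrow> real ^ 'n \<Rightarrow> real" where
  "omega_bach g \<beta> \<omega> i j p = bach g i j p - \<beta> * (\<omega> p (axis i 1) * \<omega> p (axis j 1))"

definition gradient_omega_bach_soliton ::
  "(real ^ 'n::finite) set \<Rightarrow> 'n metric \<Rightarrow> real \<Rightarrow> (real ^ 'n \<Rightarrow> real ^ 'n \<Rightarrow> real) \<Rightarrow>
    (real ^ 'n \<Rightarrow> real) \<Rightarrow> real \<Rightarrow> bool" where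
  "gradient_omega_bach_soliton U g \<beta> \<omega> f lam \<longleftrightarrow>
     open U \<and> riemannian_metric_on U g \<and> smooth_on U f \<and>
     (\<forall>p\<in>U. \<forall>i j. hessian g f p [i, j] + omega_bach g \<beta> \<omega> i j p = lam * g p $ i $ j)"

text \<open>
  Products: a point of the product of charts in \<open>real ^ 'm\<close> and \<open>real ^ 'n\<close> lies in
  \<open>real ^ ('m + 'n)\<close>, with the coordinates of the factors at the indices \<open>Inl i\<close> and \<open>Inr j\<close>.
\<close>

definition vec_join :: "real ^ 'm::finite \<Rightarrow> real ^ 'n::finite \<Rightarrow> real ^ ('m + 'n)" where
  "vec_join u v = (\<chi> i. case i of Inl a \<Rightarrow> u $ a | Inr b \<Rightarrow> v $ b)"

definition vec_left :: "real ^ ('m::finite + 'n::finite) \<Rightarrow> real ^ 'm" where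
  "vec_left p = (\<chi> a. p $ Inl a)"

definition vec_right :: "real ^ ('m::finite + 'n::finite) \<Rightarrow> real ^ 'n" where
  "vec_right p = (\<chi> b. p $ Inr b)"

definition product_domain ::
  "(real ^ 'm::finite) set \<Rightarrow> (real ^ 'n::finite) set \<Rightarrow> (real ^ ('m + 'n)) set" where
  "product_domain U V = {p. vec_left p \<in> U \<and> vec_right p \<in> V}"

definition product_metric :: "'m::finite metric \<Rightarrow> 'n::finite metric \<Rightarrow> ('m + 'n) metric" where
  "product_metric g h p = (\<chi> i j. case (i, j) of
       (Inl a, Inl b) \<Rightarrow> g (vec_left p) $ a $ b
     | (Inr a, Inr b) \<Rightarrow> h (vec_right p) $ a $ b
     | _ \<Rightarrow> 0)"

definition flat_metric :: "2 metric" where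
  "flat_metric p = mat 1"

definition upper_half_plane :: "(real ^ 2) set" where
  "upper_half_plane = {p. 0 < p $ 2}"

definition hyperbolic_metric :: "2 metric" where
  "hyperbolic_metric p = (1 / (p $ 2)\<^sup>2) *\<^sub>R mat 1"

end

theory Submission
  imports Defs
begin

text \<open>
  The Weyl tensor of the product is a combination of Kulkarni-Nomizu products of the two parallel
  tensors \<open>g\<^sup>R\<close> and \<open>g\<^sup>H\<close>, so it is parallel and only the Ricci term of the Bach tensor survives:
  \<open>B = (g\<^sup>R - g\<^sup>H) / 3\<close>. The soliton equation therefore prescribes all second partial derivatives
  of the potential \<open>F\<close> in terms of its first partial derivatives. The integrability conditions
  (symmetry of the third partial derivatives) yield \<open>\<beta> P\<^sub>i P\<^sub>j = 0\<close> for \<open>i \<in> {1, 2}\<close>, \<open>j \<in> {3, 4}\<close>,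
  and express \<open>\<partial>\<^sub>x F\<close> and \<open>\<partial>\<^sub>y F\<close> as constant multiples of \<open>1 / y\<^sup>3\<close>. Feeding this back into the
  equation forces \<open>\<lambda> = -1/3\<close>, \<open>\<beta> P\<^sub>3\<^sup>2 = \<beta> P\<^sub>4\<^sup>2 = 0\<close> and \<open>\<partial>\<^sub>x F = \<partial>\<^sub>y F = 0\<close>, so that the terms
  in \<open>y\<close> of the formula vanish and \<open>F\<close> is a quadratic polynomial in \<open>s\<close> and \<open>t\<close>.
\<close>

section \<open>Coordinate derivatives\<close>

lemma partial_eqI: "(f has_derivative D) (at p) \<Longrightarrow> partial i f p = D (axis i 1)"
  unfolding partial_def using frechet_derivative_at by metis

text \<open>The two functions have the same derivatives at \<open>p\<close>, so the choice inside
  \<open>frechet_derivative\<close> picks the same map. Closed formulas valid only for y > 0 can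
  thus be differentiated there.\<close>

lemma partial_cong:
  assumes "open U" "p \<in> U" "\<And>q. q \<in> U \<Longrightarrow> f q = g q"
  shows "partial i f p = partial i g p"
proof -
  have "(f has_derivative D) (at p) \<longleftrightarrow> (g has_derivative D) (at p)" for D
    using assms has_derivative_transform_within_open[of _ D p UNIV U] by metis
  then show ?thesis by (simp add: partial_def frechet_derivative_def)
qed

lemma partial_const [simp]: "partial i (\<lambda>q. c) p = 0"
  by (simp add: partial_def)

lemma partial_add:
  assumes "f differentiable (at p)" "g differentiable (at p)"
  shows "partial i (\<lambda>q. f q + g q) p = partial i f p + partial i g p"
  by (subst partial_eqI[OF has_derivative_add[OF assms[unfolded frechet_derivative_works]]])
    (simp add: partial_def)

lemma partial_diff:
  assumes "f differentiable (at p)" "g differentiable (at p)"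
  shows "partial i (\<lambda>q. f q - g q) p = partial i f p - partial i g p"
  by (subst partial_eqI[OF has_derivative_diff[OF assms[unfolded frechet_derivative_works]]])
    (simp add: partial_def)

lemma partial_mult:
  assumes "f differentiable (at p)" "g differentiable (at p)"
  shows "partial i (\<lambda>q. f q * g q) p = f p * partial i g p + partial i f p * g p"
  by (subst partial_eqI[OF has_derivative_mult[OF assms[unfolded frechet_derivative_works]]])
    (simp add: partial_def)

lemma
  assumes "(\<phi> has_real_derivative d) (at (p $ k))"
  shows partial_coord_fun: "partial i (\<lambda>q. \<phi> (q $ k)) p = (if i = k then d else 0)"
    and differentiable_coord_fun: "(\<lambda>q. \<phi> (q $ k)) differentiable (at p)"
proof -
  have "((\<lambda>q. q $ k) has_derivative (\<lambda>h. h $ k)) (at p)"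
    by (rule bounded_linear_imp_has_derivative) (rule bounded_linear_vec_nth)
  from has_derivative_compose[OF this assms[unfolded has_field_derivative_def]]
  have D: "((\<lambda>q. \<phi> (q $ k)) has_derivative (\<lambda>h. d * h $ k)) (at p)"
    by simp
  show "partial i (\<lambda>q. \<phi> (q $ k)) p = (if i = k then d else 0)"
    by (simp add: partial_eqI[OF D] axis_def)
  show "(\<lambda>q. \<phi> (q $ k)) differentiable (at p)"
    using D by (auto simp: differentiable_def)
qed

section \<open>Symmetry of second partial derivatives\<close>

lemma has_real_derivative_along_axis:
  assumes "f differentiable (at (q + t *\<^sub>R axis i 1))"
  shows "((\<lambda>t. f (q + t *\<^sub>R axis i 1)) has_real_derivative partial i f (q + t *\<^sub>R axis i 1)) (at t)"
proof -
  let ?D = "frechet_derivative f (at (q + t *\<^sub>R axis i 1))"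
  have D: "(f has_derivative ?D) (at (q + t *\<^sub>R axis i 1))"
    using assms frechet_derivative_works by blast
  have "((\<lambda>t. q + t *\<^sub>R axis i 1) has_derivative (\<lambda>h. h *\<^sub>R axis i 1)) (at t)"
    by (auto intro!: derivative_eq_intros)
  from has_derivative_compose[OF this D]
  have "((\<lambda>t. f (q + t *\<^sub>R axis i 1)) has_derivative (\<lambda>h. ?D (h *\<^sub>R axis i 1))) (at t)" .
  moreover have "?D (h *\<^sub>R axis i 1) = partial i f (q + t *\<^sub>R axis i 1) * h" for h
    using linear_scale[OF has_derivative_linear[OF D]] by (simp add: partial_def mult.commute)
  ultimately show ?thesis
    by (simp add: has_field_derivative_def)
qed

text \<open>Mean value theorem twice: in direction \<open>i\<close> for the difference of
  \<open>f\<close> along two parallel segments, then in direction \<open>j\<close> for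
  \<open>partial i f\<close>. The bound \<open>2 * h < r\<close> keeps all points used inside the
  ball.\<close>

lemma second_difference_eq_mixed_partial:
  fixes p :: "real ^ 'n::finite"
  assumes U: "ball p r \<subseteq> U" and h: "0 < h" "2 * h < r"
    and f: "\<And>q. q \<in> U \<Longrightarrow> f differentiable (at q)"
    and fi: "\<And>q. q \<in> U \<Longrightarrow> partial i f differentiable (at q)"
  obtains a b where "0 < a" "a < h" "0 < b" "b < h"
    "f (p + h *\<^sub>R axis i 1 + h *\<^sub>R axis j 1) - f (p + h *\<^sub>R axis i 1) - f (p + h *\<^sub>R axis j 1) + f p
      = h * h * partial j (partial i f) (p + a *\<^sub>R axis i 1 + b *\<^sub>R axis j 1)"
proof -
  have inU: "p + a *\<^sub>R axis i 1 + b *\<^sub>R axis j 1 \<in> U" if "0 \<le> a" "a \<le> h" "0 \<le> b" "b \<le> h" for a b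
  proof -
    have "norm (a *\<^sub>R axis i 1 + b *\<^sub>R axis j (1::real) :: real ^ 'n) \<le> a + b"
      using that norm_triangle_ineq[of "a *\<^sub>R axis i (1::real)" "b *\<^sub>R axis j (1::real)"] by simp
    moreover have "p + v \<in> ball p r" if "norm v < r" for v
      using that by (simp add: dist_norm)
    ultimately have "p + (a *\<^sub>R axis i 1 + b *\<^sub>R axis j 1) \<in> ball p r"
      using that h by simp
    then show ?thesis using U by (auto simp: add.assoc)
  qed
  let ?u = "\<lambda>a. f ((p + h *\<^sub>R axis j 1) + a *\<^sub>R axis i 1) - f (p + a *\<^sub>R axis i 1)"
  let ?u' = "\<lambda>a. partial i f ((p + h *\<^sub>R axis j 1) + a *\<^sub>R axis i 1) - partial i f (p + a *\<^sub>R axis i 1)"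
  have comm: "(p + t *\<^sub>R axis j 1) + a *\<^sub>R axis i 1
    = p + a *\<^sub>R axis i 1 + t *\<^sub>R axis j (1::real)" for a t
    by (simp only: add.assoc add.commute[of "t *\<^sub>R axis j 1"])
  have "(?u has_real_derivative ?u' a) (at a)" if "0 \<le> a" "a \<le> h" for a
  proof (intro DERIV_diff has_real_derivative_along_axis f)
    show "(p + h *\<^sub>R axis j 1) + a *\<^sub>R axis i 1 \<in> U"
      unfolding comm by (rule inU) (use that h in auto)
    show "p + a *\<^sub>R axis i 1 \<in> U"
      using inU[of a 0] that h by simp
  qed
  then have "\<exists>a>0. a < h \<and> ?u h - ?u 0 = (h - 0) * ?u' a"
    by (intro MVT2 h(1))
  then obtain a where a: "0 < a" "a < h" "?u h - ?u 0 = (h - 0) * ?u' a"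
    by blast
  let ?v = "\<lambda>b. partial i f ((p + a *\<^sub>R axis i 1) + b *\<^sub>R axis j 1)"
  let ?v' = "\<lambda>b. partial j (partial i f) ((p + a *\<^sub>R axis i 1) + b *\<^sub>R axis j 1)"
  have "(?v has_real_derivative ?v' b) (at b)" if "0 \<le> b" "b \<le> h" for b
    by (intro has_real_derivative_along_axis fi inU) (use that a in auto)
  then have "\<exists>b>0. b < h \<and> ?v h - ?v 0 = (h - 0) * ?v' b"
    by (intro MVT2 h(1))
  then obtain b where b: "0 < b" "b < h" "?v h - ?v 0 = (h - 0) * ?v' b"
    by blast
  have "?u' a = h * ?v' b"
    using b(3) by (simp only: comm) simp
  then have eq: "?u h - ?u 0 = h * h * ?v' b"
    using a(3) by (simp only:) simp
  show ?thesis
    by (rule that[OF a(1,2) b(1,2)]) (use eq in \<open>simp add: comm\<close>)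
qed

text \<open>The second difference is symmetric in \<open>i\<close> and \<open>j\<close>, so it is
  h^2 times each mixed partial at some point near \<open>p\<close>; continuity at \<open>p\<close>
  identifies the two values.\<close>

lemma partial_commute:
  fixes p :: "real ^ 'n::finite"
  assumes U: "open U" "p \<in> U" and f: "\<And>q. q \<in> U \<Longrightarrow> f differentiable (at q)"
    and fd: "\<And>i q. q \<in> U \<Longrightarrow> partial i f differentiable (at q)"
    and cont: "\<And>i j. continuous_on U (partial i (partial j f))"
  shows "partial i (partial j f) p = partial j (partial i f) p"
proof -
  obtain r where r: "0 < r" "ball p r \<subseteq> U"
    using U open_contains_ball by blast
  let ?x = "\<lambda>a b. p + a *\<^sub>R axis i 1 + b *\<^sub>R axis j (1::real)"
  have near: "\<exists>d>0. \<forall>a b. 0 < a \<and> a < d \<and> 0 < b \<and> b < d \<longrightarrow> \<bar>u (?x a b) - u p\<bar> < e"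
    if "continuous_on U u" "0 < e" for u :: "real ^ 'n \<Rightarrow> real" and e
  proof -
    have "isCont u p" using that U by (simp add: continuous_on_eq_continuous_at)
    then obtain d where d: "0 < d" "\<And>q. dist q p < d \<Longrightarrow> dist (u q) (u p) < e"
      using \<open>0 < e\<close> unfolding continuous_at_eps_delta by blast
    have "\<bar>u (?x a b) - u p\<bar> < e" if "0 < a" "a < d / 2" "0 < b" "b < d / 2" for a b
    proof -
      have "norm (a *\<^sub>R axis i 1 + b *\<^sub>R axis j (1::real) :: real ^ 'n) \<le> a + b"
        using that norm_triangle_ineq[of "a *\<^sub>R axis i (1::real)" "b *\<^sub>R axis j (1::real)"] by simp
      then show ?thesis
        using d(2)[of "?x a b"] that by (simp add: dist_norm add.assoc)
    qed
    then show ?thesis using d(1) by (intro exI[of _ "d / 2"]) auto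
  qed
  have "\<bar>partial i (partial j f) p - partial j (partial i f) p\<bar> \<le> e" if "0 < e" for e
  proof -
    obtain d1 where d1: "d1 > 0" "\<And>a b. 0 < a \<Longrightarrow> a < d1 \<Longrightarrow> 0 < b \<Longrightarrow> b < d1 \<Longrightarrow>
        \<bar>partial i (partial j f) (?x a b) - partial i (partial j f) p\<bar> < e / 2"
      using near[OF cont[of i j], of "e / 2"] \<open>0 < e\<close> by auto
    obtain d2 where d2: "d2 > 0" "\<And>a b. 0 < a \<Longrightarrow> a < d2 \<Longrightarrow> 0 < b \<Longrightarrow> b < d2 \<Longrightarrow>
        \<bar>partial j (partial i f) (?x a b) - partial j (partial i f) p\<bar> < e / 2"
      using near[OF cont[of j i], of "e / 2"] \<open>0 < e\<close> by auto
    define h where "h = min (min d1 d2) (r / 3)"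
    have h: "0 < h" "2 * h < r" "h \<le> d1" "h \<le> d2"
      using r d1 d2 by (auto simp: h_def)
    obtain a b where ab: "0 < a" "a < h" "0 < b" "b < h"
      "f (p + h *\<^sub>R axis i 1 + h *\<^sub>R axis j 1) - f (p + h *\<^sub>R axis i 1) - f (p + h *\<^sub>R axis j 1) + f p
        = h * h * partial j (partial i f) (p + a *\<^sub>R axis i 1 + b *\<^sub>R axis j 1)"
      using second_difference_eq_mixed_partial[OF r(2) h(1,2) f fd[of _ i], where j = j] by metis
    obtain a' b' where ab': "0 < a'" "a' < h" "0 < b'" "b' < h"
      "f (p + h *\<^sub>R axis j 1 + h *\<^sub>R axis i 1) - f (p + h *\<^sub>R axis j 1) - f (p + h *\<^sub>R axis i 1) + f p
        = h * h * partial i (partial j f) (p + a' *\<^sub>R axis j 1 + b' *\<^sub>R axis i 1)"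
      using second_difference_eq_mixed_partial[OF r(2) h(1,2) f fd[of _ j], where j = i] by metis
    have comm: "p + s *\<^sub>R axis j 1 + t *\<^sub>R axis i 1 = ?x t s" for s t
      by (simp add: add_ac)
    \<comment> \<open>In the second use the directions are exchanged, so its offsets enter
      \<open>?x\<close> in the order \<open>b'\<close>, \<open>a'\<close>.\<close>
    have "h * h * partial j (partial i f) (?x a b) = h * h * partial i (partial j f) (?x b' a')"
      using ab(5) ab'(5)[unfolded comm[of h h] comm[of a' b']] by linarith
    then have "partial j (partial i f) (?x a b) = partial i (partial j f) (?x b' a')"
      using h by simp
    then show ?thesis
      using d1(2)[of b' a'] d2(2)[of a b] ab ab' h by linarith
  qed
  then have "\<bar>partial i (partial j f) p - partial j (partial i f) p\<bar> \<le> 0"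
    by (rule dense_ge)
  then show ?thesis by simp
qed

text \<open>The partials are the values of the derivative on the standard basis, so the derivative
  itself is zero, and convexity makes the function constant.\<close>

lemma partial_zero_imp_constant:
  fixes f :: "real ^ 'n::finite \<Rightarrow> real"
  assumes "convex U" "\<And>q. q \<in> U \<Longrightarrow> f differentiable (at q)"
    and "\<And>q i. q \<in> U \<Longrightarrow> partial i f q = 0"
  obtains c where "\<And>q. q \<in> U \<Longrightarrow> f q = c"
proof -
  have "(f has_derivative (\<lambda>h. 0)) (at q within U)" if "q \<in> U" for q
  proof -
    have D: "(f has_derivative frechet_derivative f (at q)) (at q)"
      using assms(2)[OF that] frechet_derivative_works by blast
    have "frechet_derivative f (at q) b = 0" if "b \<in> Basis" for b
      using that assms(3)[OF \<open>q \<in> U\<close>] by (auto simp: Basis_vec_def partial_def)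
    then have "frechet_derivative f (at q) = (\<lambda>h. 0)"
      by (intro linear_eq_stdbasis has_derivative_linear[OF D] linear_zero)
    then show ?thesis using D has_derivative_at_withinI by metis
  qed
  then show ?thesis
    using has_derivative_zero_constant[OF assms(1)] that by metis
qed

section \<open>Consequences of smoothness\<close>

lemma smooth_on_differentiable:
  assumes "smooth_on U f" "q \<in> U"
  shows "f differentiable (at q)"
proof -
  have "C_k_on (Suc 0) U f" using assms by (simp only: smooth_on_def)
  then show ?thesis using assms by simp
qed

lemma smooth_on_partial:
  assumes "smooth_on U f"
  shows "smooth_on U (partial i f)"
  unfolding smooth_on_def
proof
  fix k
  have "C_k_on (Suc k) U f" using assms by (simp only: smooth_on_def)
  then show "C_k_on k U (partial i f)" by simp
qed

lemma smooth_on_continuous: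
  assumes "smooth_on U f"
  shows "continuous_on U f"
proof -
  have "C_k_on 0 U f" using assms by (simp only: smooth_on_def)
  then show ?thesis by simp
qed

lemma smooth_on_partial_commute:
  assumes "open U" "smooth_on U f" "p \<in> U"
  shows "partial i (partial j f) p = partial j (partial i f) p"
  using assms
  by (intro partial_commute[of U]) (auto intro: smooth_on_differentiable smooth_on_partial
    smooth_on_continuous)

section \<open>Parallel tensors\<close>

text \<open>The slots are ordered to match \<open>weyl\<close>: for X = Y this is 2 (X_ik X_jl -
  X_il X_jk).\<close>

definition kulkarni_nomizu :: "(real ^ 'n \<Rightarrow> 'n \<Rightarrow> 'n \<Rightarrow> real) \<Rightarrow> (real ^ 'n \<Rightarrow> 'n \<Rightarrow> 'n \<Rightarrow> real) \<Rightarrow>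
  'n::finite tensor" where
  "kulkarni_nomizu X Y p is =
     X p (is ! 0) (is ! 2) * Y p (is ! 1) (is ! 3) - X p (is ! 0) (is ! 3) * Y p (is ! 1) (is ! 2)
     - X p (is ! 1) (is ! 2) * Y p (is ! 0) (is ! 3) + X p (is ! 1) (is ! 3) * Y p (is ! 0) (is ! 2)"

text \<open>The covariant derivative vanishes at \<open>p\<close>, written as a rewrite rule for the
  partials; differentiability is included for the product rule.\<close>

definition parallel_at :: "'n::finite metric \<Rightarrow> (real ^ 'n \<Rightarrow> 'n \<Rightarrow> 'n \<Rightarrow> real) \<Rightarrow> real ^ 'n \<Rightarrow> bool" where
  "parallel_at g X p \<longleftrightarrow> (\<forall>i j. (\<lambda>q. X q i j) differentiable (at p)) \<and>
     (\<forall>a i j. partial a (\<lambda>q. X q i j) p =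
       (\<Sum>b\<in>UNIV. christoffel g b a i p * X p b j) + (\<Sum>b\<in>UNIV. christoffel g b a j p * X p i b))"

lemma differentiable_kulkarni_nomizu:
  assumes "parallel_at g X p" "parallel_at g Y p"
  shows "(\<lambda>q. kulkarni_nomizu X Y q is) differentiable (at p)"
  using assms unfolding kulkarni_nomizu_def parallel_at_def
  by (intro differentiable_add differentiable_diff differentiable_mult) blast+

text \<open>By the Leibniz rule the derivatives of the factors become Christoffel contractions,
  which cancel the corrections of \<open>cov_deriv\<close> in the four slots.\<close>

lemma cov_deriv_kulkarni_nomizu:
  assumes X: "parallel_at g X p" and Y: "parallel_at g Y p"
  shows "cov_deriv g (kulkarni_nomizu X Y) p [a, i, j, k, l] = 0"
proof -
  have dX: "(\<lambda>q. X q i j) differentiable (at p)" and dY: "(\<lambda>q. Y q i j) differentiable (at p)" for i j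
    using X Y by (auto simp: parallel_at_def)
  have pX: "partial a (\<lambda>q. X q i j) p =
       (\<Sum>b\<in>UNIV. christoffel g b a i p * X p b j) + (\<Sum>b\<in>UNIV. christoffel g b a j p * X p i b)"
    and pY: "partial a (\<lambda>q. Y q i j) p =
       (\<Sum>b\<in>UNIV. christoffel g b a i p * Y p b j) + (\<Sum>b\<in>UNIV. christoffel g b a j p * Y p i b)" for a i j
    using X Y by (auto simp: parallel_at_def)
  note diffs = dX dY differentiable_mult differentiable_add differentiable_diff
  show ?thesis
    by (simp add: kulkarni_nomizu_def partial_add partial_diff partial_mult diffs pX pY
        lessThan_nat_numeral numeral_eq_Suc lessThan_Suc sum.distrib sum_subtractf
        sum_distrib_left sum_distrib_right algebra_simps)
qed

lemma cov_deriv_linear: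
  assumes "\<And>is. (\<lambda>q. S q is) differentiable (at p)" "\<And>is. (\<lambda>q. T q is) differentiable (at p)"
  shows "cov_deriv g (\<lambda>q is. s * S q is + t * T q is) p is
    = s * cov_deriv g S p is + t * cov_deriv g T p is"
proof (cases "is")
  case (Cons a js)
  have "partial a (\<lambda>q. s * S q js + t * T q js) p
    = s * partial a (\<lambda>q. S q js) p + t * partial a (\<lambda>q. T q js) p"
    using assms by (simp add: partial_add partial_mult differentiable_mult)
  then show ?thesis
    using Cons by (simp add: algebra_simps sum.distrib sum_distrib_left)
qed simp

lemma cov_deriv_cong:
  assumes "open U" "p \<in> U" "\<And>q is. q \<in> U \<Longrightarrow> S q is = T q is"
  shows "cov_deriv g S p is = cov_deriv g T p is"
proof (cases "is")
  case (Cons a js)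
  have "partial a (\<lambda>q. S q js) p = partial a (\<lambda>q. T q js) p"
    using assms by (intro partial_cong[of U]) auto
  then show ?thesis using Cons assms by simp
qed simp

text \<open>Replacing an index keeps the length of the list, so only components of rank
  \<open>n\<close> enter.\<close>

lemma cov_deriv_zero:
  assumes "open U" "p \<in> U" "\<And>q is. q \<in> U \<Longrightarrow> length is = n \<Longrightarrow> T q is = 0" "length is = Suc n"
  shows "cov_deriv g T p is = 0"
proof (cases "is")
  case (Cons a js)
  have "partial a (\<lambda>q. T q js) p = partial a (\<lambda>q. 0) p"
    using assms Cons by (intro partial_cong[of U]) auto
  then show ?thesis using Cons assms by simp
qed simp

lemma hessian_eq:
  "hessian g f p [i, j] = partial i (partial j f) p - (\<Sum>b\<in>UNIV. christoffel g b i j p * partial b f p)"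
  by (simp add: hessian_def)

section \<open>Curvature of the product of the plane and the hyperbolic plane\<close>

abbreviation flat_hyp :: "(2 + 2) metric" where
  "flat_hyp \<equiv> product_metric flat_metric hyperbolic_metric"

abbreviation flat_hyp_domain :: "(real ^ (2 + 2)) set" where
  "flat_hyp_domain \<equiv> product_domain UNIV upper_half_plane"

text \<open>The summand of the product metric pulled back from the plane. The coordinates s, t, x, y
  have the indices \<open>Inl 1\<close>, \<open>Inl 2\<close>, \<open>Inr 1\<close>,
  \<open>Inr 2\<close>.\<close>

definition flat_part :: "real ^ (2 + 2) \<Rightarrow> 2 + 2 \<Rightarrow> 2 + 2 \<Rightarrow> real" where
  "flat_part p i j = (if i = j \<and> isl i then 1 else 0)"

definition hyp_part :: "real ^ (2 + 2) \<Rightarrow> 2 + 2 \<Rightarrow> 2 + 2 \<Rightarrow> real" where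
  "hyp_part p i j = (if i = j \<and> \<not> isl i then 1 / (p $ Inr 2)\<^sup>2 else 0)"

lemma one_neq_two [simp]: "(1::2) \<noteq> 2" "(2::2) \<noteq> 1"
  by simp_all

text \<open>Splits tensor identities, stated below with object-level quantifiers over indices, into
  finitely many component identities.\<close>

lemma forall_plus_2: "(\<forall>i::2 + 2. P i) \<longleftrightarrow> P (Inl 1) \<and> P (Inl 2) \<and> P (Inr 1) \<and> P (Inr 2)"
  by (simp add: split_sum_all forall_2 conj_assoc)

lemma sum_plus_2: "(\<Sum>i\<in>(UNIV :: (2 + 2) set). f i)
  = f (Inl 1) + f (Inl 2) + f (Inr 1) + (f (Inr 2) :: real)"
proof -
  have "(UNIV :: (2 + 2) set) = {Inl 1, Inl 2, Inr 1, Inr 2}"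
    by (auto simp: UNIV_sum UNIV_2)
  then show ?thesis unfolding \<open>UNIV = _\<close> by simp
qed

lemma flat_part_simps [simp]:
  "flat_part p (Inr a) j = 0" "flat_part p i (Inr a) = 0"
  "flat_part p (Inl a) (Inl b) = (if a = b then 1 else 0)"
  by (auto simp: flat_part_def)

lemma hyp_part_simps [simp]:
  "hyp_part p (Inl a) j = 0" "hyp_part p i (Inl a) = 0"
  "hyp_part p (Inr a) (Inr b) = (if a = b then 1 / (p $ Inr 2)\<^sup>2 else 0)"
  by (auto simp: hyp_part_def)

lemma mem_flat_hyp_domain: "p \<in> flat_hyp_domain \<longleftrightarrow> 0 < p $ Inr 2"
  by (simp add: product_domain_def upper_half_plane_def vec_right_def)

lemma open_flat_hyp_domain: "open flat_hyp_domain"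
proof -
  have "flat_hyp_domain = {p. 0 < p $ Inr 2}"
    using mem_flat_hyp_domain by blast
  then show ?thesis by (simp add: open_halfspace_component_gt_cart)
qed

lemma convex_flat_hyp_domain: "convex flat_hyp_domain"
proof -
  have "flat_hyp_domain = {p. axis (Inr 2) 1 \<bullet> p > 0}"
    by (auto simp: mem_flat_hyp_domain cart_eq_inner_axis inner_commute)
  then show ?thesis by (simp add: convex_halfspace_gt)
qed

lemma flat_hyp_nth: "flat_hyp p $ i $ j = flat_part p i j + hyp_part p i j"
  by (cases i; cases j) (auto simp: product_metric_def flat_part_def hyp_part_def flat_metric_def
      hyperbolic_metric_def mat_def vec_right_def)

lemma inverse_flat_hyp_nth:
  assumes "p \<in> flat_hyp_domain"
  shows "inverse_metric flat_hyp p $ i $ j = (if i = j then if isl i then 1 else (p $ Inr 2)\<^sup>2 else 0)"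
proof -
  let ?B = "(\<chi> i j. if i = j then if isl i then 1 else (p $ Inr 2)\<^sup>2 else 0) :: real ^ (2 + 2) ^ (2 + 2)"
  have y: "p $ Inr 2 \<noteq> 0" using assms by (simp add: mem_flat_hyp_domain)
  have "(flat_hyp p ** ?B) $ i $ j = mat 1 $ i $ j" for i j
  proof -
    have "\<forall>i j. (flat_hyp p ** ?B) $ i $ j = mat 1 $ i $ j" using y
      by (simp add: forall_plus_2 matrix_matrix_mult_def sum_plus_2 flat_hyp_nth flat_part_def
        hyp_part_def mat_def)
    then show ?thesis by blast
  qed
  then have 1: "flat_hyp p ** ?B = mat 1" by (simp add: vec_eq_iff)
  then have 2: "?B ** flat_hyp p = mat 1" using matrix_left_right_inverse by blast
  have "matrix_inv (flat_hyp p) = ?B"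
    unfolding matrix_inv_def
  proof (rule some_equality)
    \<comment> \<open>\<open>matrix_inv\<close> is defined by choice, so uniqueness of the two-sided
      inverse identifies it.\<close>
    fix A assume A: "flat_hyp p ** A = mat 1 \<and> A ** flat_hyp p = mat 1"
    then have "A = A ** (flat_hyp p ** ?B)" by (simp add: 1)
    also have "\<dots> = ?B" using A by (simp add: matrix_mul_assoc)
    finally show "A = ?B" .
  qed (use 1 2 in simp)
  then show ?thesis by (simp add: inverse_metric_def)
qed

text \<open>The coefficients of the metric, the connection and the soliton equation all have the
  form c / y^n; \<open>n = 0\<close> covers constants.\<close>

lemma
  fixes p :: "real ^ (2 + 2)"
  assumes "p \<in> flat_hyp_domain"
  shows differentiable_divide_height_power: "(\<lambda>q. c / (q $ Inr 2) ^ n) differentiable (at p)"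
    and partial_divide_height_power: "partial a (\<lambda>q. c / (q $ Inr 2) ^ n) p = (if a
      = Inr 2 then - real n * c / (p $ Inr 2) ^ Suc n else 0)"
proof -
  have y: "p $ Inr 2 \<noteq> 0" using assms by (simp add: mem_flat_hyp_domain)
  have "((\<lambda>y. c / y ^ n) has_real_derivative - real n * c / (p $ Inr 2) ^ Suc n) (at (p $ Inr 2))"
  proof (cases n)
    case (Suc m)
    then show ?thesis
      using y by (intro DERIV_cong[OF DERIV_divide[OF DERIV_const DERIV_pow]])
        (simp_all add: field_simps)
  qed simp
  note * = partial_coord_fun[OF this] differentiable_coord_fun[OF this]
  show "(\<lambda>q. c / (q $ Inr 2) ^ n) differentiable (at p)" using * by blast
  show "partial a (\<lambda>q. c / (q $ Inr 2) ^ n) p = (if a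
    = Inr 2 then - real n * c / (p $ Inr 2) ^ Suc n else 0)"
    using *(1)[of a] by simp
qed

lemma differentiable_flat_part: "(\<lambda>q. flat_part q i j) differentiable (at p)"
  by (simp add: flat_part_def)

lemma partial_flat_part: "partial a (\<lambda>q. flat_part q i j) p = 0"
  by (simp add: flat_part_def)

lemma hyp_part_eq: "hyp_part p i j = (if i = j \<and> \<not> isl i then 1 else 0) / (p $ Inr 2)\<^sup>2"
  by (auto simp: hyp_part_def)

lemma differentiable_hyp_part:
  assumes "p \<in> flat_hyp_domain"
  shows "(\<lambda>q. hyp_part q i j) differentiable (at p)"
  unfolding hyp_part_eq by (rule differentiable_divide_height_power[OF assms])

lemma partial_hyp_part:
  assumes "p \<in> flat_hyp_domain"
  shows "partial a (\<lambda>q. hyp_part q i j) p = (if a = Inr 2 \<and> i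
    = j \<and> \<not> isl i then - 2 / (p $ Inr 2) ^ 3 else 0)"
  unfolding hyp_part_eq partial_divide_height_power[OF assms] by (auto simp: eval_nat_numeral)

section \<open>Connection, curvature and Bach tensor\<close>

lemma partial_flat_hyp:
  assumes "p \<in> flat_hyp_domain"
  shows "partial a (\<lambda>q. flat_hyp q $ i $ j) p = (if a = Inr 2 \<and> i
    = j \<and> \<not> isl i then - 2 / (p $ Inr 2) ^ 3 else 0)"
  using assms by (simp add: flat_hyp_nth partial_add differentiable_flat_part differentiable_hyp_part
      partial_flat_part partial_hyp_part)

text \<open>Numerators of the Christoffel symbols over y. They follow the conformal formula for e^(2
  phi) times the flat metric with phi = - ln y.\<close>

definition hyp_christoffel :: "2 + 2 \<Rightarrow> 2 + 2 \<Rightarrow> 2 + 2 \<Rightarrow> real" where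
  "hyp_christoffel c a b = (if isl a \<or> isl b \<or> isl c then 0 else
     (if a = b \<and> c = Inr 2 then 1 else 0) - (if c = a \<and> b = Inr 2 then 1 else 0)
     - (if c = b \<and> a = Inr 2 then 1 else 0))"

lemma hyp_christoffel_simps [simp]:
  "hyp_christoffel (Inl c') a b = 0" "hyp_christoffel c (Inl a') b
    = 0" "hyp_christoffel c a (Inl b') = 0"
  "hyp_christoffel (Inr 1) (Inr 1) (Inr 1) = 0" "hyp_christoffel (Inr 1) (Inr 1) (Inr 2) = - 1"
  "hyp_christoffel (Inr 1) (Inr 2) (Inr 1) = - 1" "hyp_christoffel (Inr 1) (Inr 2) (Inr 2) = 0"
  "hyp_christoffel (Inr 2) (Inr 1) (Inr 1) = 1" "hyp_christoffel (Inr 2) (Inr 1) (Inr 2) = 0"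
  "hyp_christoffel (Inr 2) (Inr 2) (Inr 1) = 0" "hyp_christoffel (Inr 2) (Inr 2) (Inr 2) = - 1"
  by (auto simp: hyp_christoffel_def)

lemma christoffel_flat_hyp:
  assumes "p \<in> flat_hyp_domain"
  shows "christoffel flat_hyp c a b p = hyp_christoffel c a b / p $ Inr 2"
proof -
  have y: "p $ Inr 2 \<noteq> 0" using assms by (simp add: mem_flat_hyp_domain)
  have "\<forall>c a b. christoffel flat_hyp c a b p = hyp_christoffel c a b / p $ Inr 2"
    unfolding christoffel_def sum_plus_2 partial_flat_hyp[OF assms] inverse_flat_hyp_nth[OF assms]
    using y by (simp add: forall_plus_2 power2_eq_square power3_eq_cube)
  then show ?thesis by blast
qed

lemma partial_christoffel_flat_hyp:
  assumes "p \<in> flat_hyp_domain"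
  shows "partial d (christoffel flat_hyp c a b) p = (if d
    = Inr 2 then - hyp_christoffel c a b / (p $ Inr 2)\<^sup>2 else 0)"
proof -
  have "partial d (christoffel flat_hyp c a b) p
    = partial d (\<lambda>q. hyp_christoffel c a b / (q $ Inr 2) ^ 1) p"
    using assms by (intro partial_cong[OF open_flat_hyp_domain]) (simp_all add: christoffel_flat_hyp)
  then show ?thesis
    using partial_divide_height_power[OF assms, of d "hyp_christoffel c a b" 1]
      by (simp add: power2_eq_square)
qed

text \<open>Only the hyperbolic factor is curved, with Gauss curvature - 1.\<close>

lemma riemann_flat_hyp:
  assumes "p \<in> flat_hyp_domain"
  shows "riemann flat_hyp i j k l p
    = - (hyp_part p i k * hyp_part p j l - hyp_part p i l * hyp_part p j k)"
proof -
  have y: "p $ Inr 2 \<noteq> 0" using assms by (simp add: mem_flat_hyp_domain)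
  have "\<forall>i j k l. riemann flat_hyp i j k l p
    = - (hyp_part p i k * hyp_part p j l - hyp_part p i l * hyp_part p j k)"
    unfolding riemann_def riemann_up_def sum_plus_2 christoffel_flat_hyp[OF assms]
      partial_christoffel_flat_hyp[OF assms]
      flat_hyp_nth
    using y by (simp add: forall_plus_2 power2_eq_square)
  then show ?thesis by blast
qed

lemma ricci_flat_hyp:
  assumes "p \<in> flat_hyp_domain"
  shows "ricci flat_hyp i k p = - hyp_part p i k"
proof -
  have y: "p $ Inr 2 \<noteq> 0" using assms by (simp add: mem_flat_hyp_domain)
  have "\<forall>i k. ricci flat_hyp i k p = - hyp_part p i k"
    unfolding ricci_def riemann_flat_hyp[OF assms] sum_plus_2 inverse_flat_hyp_nth[OF assms]
    using y by (simp add: forall_plus_2 power2_eq_square)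
  then show ?thesis by blast
qed

lemma scalar_curvature_flat_hyp:
  assumes "p \<in> flat_hyp_domain"
  shows "scalar_curvature flat_hyp p = - 2"
  unfolding scalar_curvature_def ricci_flat_hyp[OF assms] sum_plus_2 inverse_flat_hyp_nth[OF assms]
  using assms by (simp add: mem_flat_hyp_domain)

text \<open>Let f, h be the flat and hyperbolic parts and KN the Kulkarni-Nomizu product. The
  Riemann tensor is - KN(h, h) / 2, Ric = - h and the scalar curvature is - 2, so in dimension 4 the
  Weyl tensor is - KN(h, h) / 2 + KN(f + h, h) / 2 - KN(f + h, f + h) / 6.\<close>

lemma weyl_tensor_flat_hyp:
  assumes "p \<in> flat_hyp_domain"
  shows "weyl_tensor flat_hyp p is =
    (kulkarni_nomizu flat_part hyp_part p is - kulkarni_nomizu flat_part flat_part p is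
      - kulkarni_nomizu hyp_part hyp_part p is) / 6"
proof -
  have [simp]: "hyp_part p j i = hyp_part p i j" "flat_part p j i = flat_part p i j" for i j
    by (auto simp: hyp_part_def flat_part_def)
  show ?thesis
  unfolding weyl_tensor_def weyl_def kulkarni_nomizu_def riemann_flat_hyp[OF assms]
    ricci_flat_hyp[OF assms]
    scalar_curvature_flat_hyp[OF assms] flat_hyp_nth
   by (simp add: algebra_simps add_divide_distrib diff_divide_distrib)
qed

lemma parallel_flat_part:
  assumes "p \<in> flat_hyp_domain"
  shows "parallel_at flat_hyp flat_part p"
  unfolding parallel_at_def partial_flat_part christoffel_flat_hyp[OF assms]
  by (simp add: differentiable_flat_part sum_plus_2 forall_plus_2)

text \<open>Metric compatibility of the Levi-Civita connection of the hyperbolic plane, checked by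
  components.\<close>

lemma parallel_hyp_part:
  assumes "p \<in> flat_hyp_domain"
  shows "parallel_at flat_hyp hyp_part p"
proof -
  have y: "p $ Inr 2 \<noteq> 0" using assms by (simp add: mem_flat_hyp_domain)
  show ?thesis
    unfolding parallel_at_def partial_hyp_part[OF assms] christoffel_flat_hyp[OF assms] sum_plus_2
    using differentiable_hyp_part[OF assms] y
    by (simp add: forall_plus_2 power2_eq_square power3_eq_cube)
qed

lemma cov_deriv_weyl_flat_hyp:
  assumes "p \<in> flat_hyp_domain"
  shows "cov_deriv flat_hyp (weyl_tensor flat_hyp) p [a, i, j, k, l] = 0"
proof -
  note parallel = parallel_flat_part[OF assms] parallel_hyp_part[OF assms]
  note [simp] = differentiable_kulkarni_nomizu[OF parallel(1) parallel(1)]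
    differentiable_kulkarni_nomizu[OF parallel(1) parallel(2)]
    differentiable_kulkarni_nomizu[OF parallel(2) parallel(2)]
  \<comment> \<open>The combination is nested, with a factor 1, so that the two-term rule
    \<open>cov_deriv_linear\<close> applies twice.\<close>
  have "cov_deriv flat_hyp (weyl_tensor flat_hyp) p [a, i, j, k, l] =
    cov_deriv flat_hyp (\<lambda>q is. 1 / 6 * kulkarni_nomizu flat_part hyp_part q is + 1 *
      (- 1 / 6 * kulkarni_nomizu flat_part flat_part q is
        + - 1 / 6 * kulkarni_nomizu hyp_part hyp_part q is)) p
      [a, i, j, k, l]"
    by (rule cov_deriv_cong[OF open_flat_hyp_domain assms]) (simp add: weyl_tensor_flat_hyp)
  also have "\<dots> = 0"
    by (subst cov_deriv_linear, simp, simp add: differentiable_add differentiable_mult,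
        subst cov_deriv_linear) (simp_all only: cov_deriv_kulkarni_nomizu parallel, simp_all)
  finally show ?thesis .
qed

text \<open>The derivative term vanishes, as the Weyl tensor is parallel. Since -2 / (n - 2) = -1
  and Ric = - h, what remains is the trace of the Weyl tensor against h in its second and fourth
  slots; this trace is 2 f for KN(f, h), 2 h for KN(h, h) and 0 for KN(f, f).\<close>

lemma bach_flat_hyp:
  assumes "p \<in> flat_hyp_domain"
  shows "bach flat_hyp i j p = (flat_part p i j - hyp_part p i j) / 3"
proof -
  have y: "p $ Inr 2 \<noteq> 0" using assms by (simp add: mem_flat_hyp_domain)
  have cov: "cov_deriv flat_hyp (cov_deriv flat_hyp (weyl_tensor flat_hyp)) p [a, b, i, k, j, l]
    = 0" for a b i j k l
    using cov_deriv_weyl_flat_hyp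
    by (intro cov_deriv_zero[OF open_flat_hyp_domain assms, of 5])
      (auto simp: numeral_eq_Suc length_Suc_conv simp del: cov_deriv.simps)
  have weyl: "weyl flat_hyp i k j l p = weyl_tensor flat_hyp p [i, k, j, l]" for i j k l
    by (simp add: weyl_tensor_def numeral_eq_Suc)
  have card: "real CARD(2 + 2) = 4"
    by simp
  \<comment> \<open>The inverse metric is diagonal, which collapses the sums over \<open>a\<close>
    and \<open>b\<close> before components are expanded.\<close>
  have "(\<Sum>a\<in>UNIV. \<Sum>b\<in>UNIV. inverse_metric flat_hyp p $ k $ a * inverse_metric flat_hyp p $ l $ b * X a b)
    = inverse_metric flat_hyp p $ k $ k * inverse_metric flat_hyp p $ l $ l * X k l" for k l X
    by (simp add: inverse_flat_hyp_nth[OF assms] if_distrib[of "\<lambda>c. c * _"] if_distrib[of "\<lambda>c. _ *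
      c"] cong: if_cong)
  then have *: "bach flat_hyp i j p = - (\<Sum>k\<in>UNIV. \<Sum>l\<in>UNIV.
     inverse_metric flat_hyp p $ k $ k * inverse_metric flat_hyp p $ l $ l *
       (ricci flat_hyp k l p * weyl_tensor flat_hyp p [i, k, j, l]))" for i j
    unfolding bach_def cov weyl card by (simp add: sum_distrib_left sum_negf)
  have "\<forall>i j. bach flat_hyp i j p = (flat_part p i j - hyp_part p i j) / 3"
    unfolding * weyl_tensor_flat_hyp[OF assms] ricci_flat_hyp[OF assms] kulkarni_nomizu_def
      inverse_flat_hyp_nth[OF assms] sum_plus_2
    using y by (simp add: forall_plus_2 power2_eq_square numeral_eq_Suc)
  then show ?thesis by blast
qed

section \<open>Integrating the soliton equation\<close>

lemma partial_coord: "partial i (\<lambda>q. q $ k) p = (if i = k then 1 else 0)"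
  and differentiable_coord: "(\<lambda>q. q $ k) differentiable (at p)"
  using partial_coord_fun[OF DERIV_ident, of i k p] differentiable_coord_fun[OF DERIV_ident, of k
    p] by auto

text \<open>The vector \<open>v\<close> with its index lowered by the product metric.\<close>

definition dual_component :: "real ^ (2 + 2) \<Rightarrow> real ^ (2 + 2) \<Rightarrow> 2 + 2 \<Rightarrow> real" where
  "dual_component v p i = (case i of Inl a \<Rightarrow> v $ i | Inr a \<Rightarrow> v $ i / (p $ Inr 2)\<^sup>2)"

lemma dual_form_flat_hyp: "dual_form flat_hyp (\<lambda>_. v) p (axis i 1) = dual_component v p i"
proof -
  have "\<forall>i. dual_form flat_hyp (\<lambda>_. v) p (axis i 1) = dual_component v p i"
    by (simp add: forall_plus_2 dual_form_def dual_component_def inner_axis'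
      matrix_vector_mult_def flat_hyp_nth sum_plus_2)
  then show ?thesis by blast
qed

text \<open>The Bach tensor (f - h) / 3 shifts \<open>lam\<close> by - 1/3 on the flat part and by
  1/3 on the hyperbolic part; the Christoffel term of the Hessian moves to the right.\<close>

lemma soliton_second_partials:
  assumes sol: "gradient_omega_bach_soliton flat_hyp_domain flat_hyp \<beta> (dual_form flat_hyp (\<lambda>_.
    v)) F lam"
    and p: "p \<in> flat_hyp_domain"
  shows "partial i (partial j F) p = (lam - 1/3) * flat_part p i j + (lam + 1/3) * hyp_part p i j
    + \<beta> * dual_component v p i * dual_component v p j
    + (\<Sum>b\<in>UNIV. hyp_christoffel b i j * partial b F p) / p $ Inr 2"
proof -
  have "hessian flat_hyp F p [i, j] + omega_bach flat_hyp \<beta> (dual_form flat_hyp (\<lambda>_. v)) i j p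
    = lam * flat_hyp p $ i $ j"
    using sol p by (simp add: gradient_omega_bach_soliton_def)
  then show ?thesis
    unfolding hessian_eq omega_bach_def bach_flat_hyp[OF p] dual_form_flat_hyp flat_hyp_nth
      christoffel_flat_hyp[OF p]
    by (simp add: sum_divide_distrib algebra_simps diff_divide_distrib add_divide_distrib)
qed

locale flat_hyp_soliton =
  fixes \<beta> lam :: real and v :: "real ^ (2 + 2)" and F :: "real ^ (2 + 2) \<Rightarrow> real"
  assumes soliton: "gradient_omega_bach_soliton flat_hyp_domain flat_hyp \<beta> (dual_form flat_hyp
    (\<lambda>_. v)) F lam"
begin

lemma smooth: "smooth_on flat_hyp_domain F"
  using soliton by (simp add: gradient_omega_bach_soliton_def)

lemmas diff_partial = smooth_on_differentiable[OF smooth_on_partial[OF smooth]]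

lemma third_partials_commute:
  assumes "p \<in> flat_hyp_domain"
  shows "partial i (partial j (partial k F)) p = partial j (partial i (partial k F)) p"
  by (rule smooth_on_partial_commute[OF open_flat_hyp_domain smooth_on_partial[OF smooth] assms])

text \<open>
  The factors \<open>1 / (p $ Inr 2) ^ 1\<close> are kept in this form to match \<open>partial_second_partial\<close> below.
\<close>

lemma second_partials:
  assumes "p \<in> flat_hyp_domain"
  shows "partial (Inl a) (partial (Inl b) F) p = (if a
    = b then lam - 1/3 else 0) + \<beta> * v $ Inl a * v $ Inl b"
    and "partial (Inl a) (partial (Inr b) F) p = \<beta> * v $ Inl a * v $ Inr b / (p $ Inr 2)\<^sup>2"
    and "partial (Inr b) (partial (Inl a) F) p = \<beta> * v $ Inl a * v $ Inr b / (p $ Inr 2)\<^sup>2"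
    and "partial (Inr 1) (partial (Inr 1) F) p
      = (lam + 1/3) / (p $ Inr 2)\<^sup>2 + \<beta> * (v $ Inr 1)\<^sup>2 / (p $ Inr 2) ^ 4
      + 1 / (p $ Inr 2) ^ 1 * partial (Inr 2) F p"
    and "partial (Inr 1) (partial (Inr 2) F) p = \<beta> * v $ Inr 1 * v $ Inr 2 / (p $ Inr 2) ^ 4
      + - 1 / (p $ Inr 2) ^ 1 * partial (Inr 1) F p"
    and "partial (Inr 2) (partial (Inr 1) F) p = \<beta> * v $ Inr 1 * v $ Inr 2 / (p $ Inr 2) ^ 4
      + - 1 / (p $ Inr 2) ^ 1 * partial (Inr 1) F p"
    and "partial (Inr 2) (partial (Inr 2) F) p
      = (lam + 1/3) / (p $ Inr 2)\<^sup>2 + \<beta> * (v $ Inr 2)\<^sup>2 / (p $ Inr 2) ^ 4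
      + - 1 / (p $ Inr 2) ^ 1 * partial (Inr 2) F p"
  unfolding soliton_second_partials[OF soliton assms]
  by (simp_all add: sum_plus_2 dual_component_def eval_nat_numeral mult_ac)

text \<open>A common template for the right-hand sides in \<open>second_partials\<close>; absent
  terms are supplied with coefficient 0.\<close>

lemma partial_second_partial:
  assumes p: "p \<in> flat_hyp_domain"
    and eq: "\<And>q. q \<in> flat_hyp_domain \<Longrightarrow> partial i (partial j F) q =
      c / (q $ Inr 2) ^ m + d / (q $ Inr 2) ^ n + e / (q $ Inr 2) ^ 1 * partial k F q"
  shows "partial l (partial i (partial j F)) p =
    (if l = Inr 2 then - real m * c / (p $ Inr 2) ^ Suc m - real n * d / (p $ Inr 2) ^ Suc n
       - e / (p $ Inr 2)\<^sup>2 * partial k F p else 0) + e / (p $ Inr 2) * partial l (partial k F) p"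
proof -
  have "partial l (partial i (partial j F)) p =
      partial l (\<lambda>q. c / (q $ Inr 2) ^ m + d / (q $ Inr 2) ^ n + e / (q $ Inr 2) ^ 1 * partial k F q) p"
    by (rule partial_cong[OF open_flat_hyp_domain p eq])
  also have "\<dots> = partial l (\<lambda>q. c / (q $ Inr 2) ^ m) p + partial l (\<lambda>q. d / (q $ Inr 2) ^ n) p
      + (e / (p $ Inr 2) ^ 1 * partial l (partial k F) p
        + partial l (\<lambda>q. e / (q $ Inr 2) ^ 1) p * partial k F p)"
    by (simp only: partial_add partial_mult differentiable_add differentiable_mult
        differentiable_divide_height_power[OF p] diff_partial[OF p])
  finally show ?thesis
    unfolding partial_divide_height_power[OF p] by (auto simp: power2_eq_square)
qed

section \<open>Integrability conditions\<close>

lemma mixed_coefficients_vanish: "\<beta> * v $ Inl a * v $ Inr b = 0"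
proof -
  \<comment> \<open>One point suffices because the coefficients are constant; y = 1 removes the
    powers of y.\<close>
  define p :: "real ^ (2 + 2)" where "p = axis (Inr 2) 1"
  have y: "p $ Inr 2 = 1" by (simp add: p_def)
  then have p: "p \<in> flat_hyp_domain" by (simp add: mem_flat_hyp_domain)
  note D = partial_second_partial[OF p]
  \<comment> \<open>Here \<open>e = 0\<close>, so the index given for \<open>k\<close> is
    arbitrary.\<close>
  have "partial (Inr 2) (partial (Inr 1) (partial (Inl a) F)) p = - 2 * (\<beta> * v $ Inl a * v $ Inr 1)"
    using D[of "Inr 1" "Inl a" "\<beta> * v $ Inl a * v $ Inr 1" 2 0 0 0 "Inr 1" "Inr 2"]
      by (simp add: second_partials y)
  moreover have "partial (Inr 1) (partial (Inr 2) (partial (Inl a) F)) p = 0"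
    using D[of "Inr 2" "Inl a" "\<beta> * v $ Inl a * v $ Inr 2" 2 0 0 0 "Inr 1" "Inr 1"]
      by (simp add: second_partials y)
  ultimately have "\<beta> * v $ Inl a * v $ Inr 1 = 0"
    using third_partials_commute[OF p, of "Inr 2" "Inr 1" "Inl a"] by simp
  moreover have "\<beta> * v $ Inl a * v $ Inr 2 = 0"
  proof -
    \<comment> \<open>In the equation for the second x-derivative, only the Christoffel term
      \<open>partial (Inr 2) F\<close> / y can vary in a flat direction.\<close>
    have "partial (Inl a) (partial (Inr 1) (partial (Inr 1) F)) p = \<beta> * v $ Inl a * v $ Inr 2"
      using D[OF second_partials(4), of "Inl a"] p by (simp add: second_partials y)
    moreover have "partial (Inr 1) (partial (Inl a) (partial (Inr 1) F)) p = 0"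
      using D[of "Inl a" "Inr 1" "\<beta> * v $ Inl a * v $ Inr 1" 2 0 0 0 "Inr 1" "Inr 1"]
        by (simp add: second_partials y)
    ultimately show ?thesis
      using third_partials_commute[OF p, of "Inr 1" "Inl a" "Inr 1"] by simp
  qed
  ultimately show ?thesis
    using exhaust_2[of b] by metis
qed

text \<open>Inserting the second partials into the symmetry of third partials leaves linear
  equations for the gradient: the triple x, y, y determines \<open>partial (Inr 1) F\<close> and the
  triple y, x, x determines \<open>partial (Inr 2) F\<close>. The terms in \<open>lam + 1/3\<close>
  cancel.\<close>

lemma hyp_gradient:
  assumes p: "p \<in> flat_hyp_domain"
  shows "partial (Inr 1) F p = 4 * (\<beta> * v $ Inr 1 * v $ Inr 2) / (p $ Inr 2) ^ 3"
    and "partial (Inr 2) F p = \<beta> * ((v $ Inr 2)\<^sup>2 - 3 * (v $ Inr 1)\<^sup>2) / (p $ Inr 2) ^ 3"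
proof -
  have y: "p $ Inr 2 \<noteq> 0" using p by (simp add: mem_flat_hyp_domain)
  \<comment> \<open>The first variant presets the second power term to zero, for the mixed equation,
    which has only one.\<close>
  note D = partial_second_partial[OF p, where d = 0 and n = 0] partial_second_partial[OF p]
  have 1: "partial (Inr 1) (partial (Inr 2) (partial (Inr 2) F)) p
    = - 1 / p $ Inr 2 * partial (Inr 1) (partial (Inr 2) F) p"
    using D(2)[OF second_partials(7), of "Inr 1"] by simp
  have 2: "partial (Inr 2) (partial (Inr 1) (partial (Inr 2) F)) p
    = - 4 * (\<beta> * v $ Inr 1 * v $ Inr 2) / (p $ Inr 2) ^ 5
      + 1 / (p $ Inr 2)\<^sup>2 * partial (Inr 1) F p - 1 / p $ Inr 2 * partial (Inr 2) (partial (Inr 1) F) p"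
    using D(1)[of "Inr 1" "Inr 2" "\<beta> * v $ Inr 1 * v $ Inr 2" 4 "- 1" "Inr 1" "Inr 2"]
    by (simp add: second_partials eval_nat_numeral)
  have 3: "partial (Inr 2) (partial (Inr 1) (partial (Inr 1) F)) p = - 2 * (lam + 1/3) / (p $ Inr 2) ^ 3
      - 4 * (\<beta> * (v $ Inr 1)\<^sup>2) / (p $ Inr 2) ^ 5
      - 1 / (p $ Inr 2)\<^sup>2 * partial (Inr 2) F p + 1 / p $ Inr 2 * partial (Inr 2) (partial (Inr 2) F) p"
    using D(2)[OF second_partials(4), of "Inr 2"] by (simp add: eval_nat_numeral)
  have 4: "partial (Inr 1) (partial (Inr 2) (partial (Inr 1) F)) p
    = - 1 / p $ Inr 2 * partial (Inr 1) (partial (Inr 1) F) p"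
    using D(1)[of "Inr 2" "Inr 1" "\<beta> * v $ Inr 1 * v $ Inr 2" 4 "- 1" "Inr 1" "Inr 1"]
    by (simp add: second_partials eval_nat_numeral)
  show "partial (Inr 1) F p = 4 * (\<beta> * v $ Inr 1 * v $ Inr 2) / (p $ Inr 2) ^ 3"
    using third_partials_commute[OF p, of "Inr 1" "Inr 2" "Inr 2"] y
    unfolding 1 2 second_partials[OF p] by (simp add: field_simps eval_nat_numeral)
  \<comment> \<open>In 1 / y the identity is polynomial, and \<open>?u\<^sup>2\<close> is the
    coefficient of \<open>?f\<close> that remains.\<close>
  let ?u = "inverse (p $ Inr 2)" and ?f = "partial (Inr 2) F p"
  have "?u\<^sup>2 * ?f = ?u\<^sup>2 * (\<beta> * ((v $ Inr 2)\<^sup>2 - 3 * (v $ Inr 1)\<^sup>2) * ?u ^ 3)"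
    using third_partials_commute[OF p, of "Inr 2" "Inr 1" "Inr 1"]
    unfolding 3 4 second_partials[OF p] divide_inverse power_inverse[symmetric]
    by (simp add: algebra_simps eval_nat_numeral)
  then show "?f = \<beta> * ((v $ Inr 2)\<^sup>2 - 3 * (v $ Inr 1)\<^sup>2) / (p $ Inr 2) ^ 3"
    using y by (simp add: divide_inverse power_inverse)
qed

text \<open>By \<open>hyp_gradient\<close> the x- and y-derivatives of \<open>F\<close> depend on y
  alone, so their x-derivatives vanish and the corresponding soliton equations become identities in
  y between constants.\<close>

lemma hyp_coefficients_vanish: "lam + 1/3 = 0" "\<beta> * (v $ Inr 1)\<^sup>2 = 0" "\<beta> * (v $ Inr 2)\<^sup>2
  = 0" "\<beta> * v $ Inr 1 * v $ Inr 2 = 0"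
proof -
  let ?c = "\<beta> * ((v $ Inr 2)\<^sup>2 - 3 * (v $ Inr 1)\<^sup>2)" and ?d = "4 * (\<beta> * v $ Inr 1 * v $ Inr 2)"
  have "partial (Inr 1) (partial (Inr 1) F) p = 0" "partial (Inr 1) (partial (Inr 2) F) p = 0"
    if p: "p \<in> flat_hyp_domain" for p
  proof -
    have "partial (Inr 1) (partial (Inr 1) F) p = partial (Inr 1) (\<lambda>q. ?d / (q $ Inr 2) ^ 3) p"
      "partial (Inr 1) (partial (Inr 2) F) p = partial (Inr 1) (\<lambda>q. ?c / (q $ Inr 2) ^ 3) p"
      using hyp_gradient p by (auto intro!: partial_cong[OF open_flat_hyp_domain])
    then show "partial (Inr 1) (partial (Inr 1) F) p = 0" "partial (Inr 1) (partial (Inr 2) F) p = 0"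
      unfolding partial_divide_height_power[OF p] by simp_all
  qed
  then have *: "(lam + 1/3) / y\<^sup>2 + \<beta> * (v $ Inr 1)\<^sup>2 / y ^ 4 + 1 / y ^ 1 * (?c / y ^ 3) = 0"
    "\<beta> * v $ Inr 1 * v $ Inr 2 / y ^ 4 + - 1 / y ^ 1 * (?d / y ^ 3) = 0" if "0 < y" for y
    using that second_partials(4,5)[of "axis (Inr 2) y"] hyp_gradient[of "axis (Inr 2) y"]
    by (simp_all only: mem_flat_hyp_domain axis_nth)
  \<comment> \<open>The values at y = 1 and y = 2 separate the powers y^-2 and y^-4.\<close>
  have coeffs: "lam + 1/3 + \<beta> * (v $ Inr 1)\<^sup>2 + ?c = 0" "4 * (lam + 1/3) + \<beta> * (v $ Inr 1)\<^sup>2 + ?c = 0"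
    using *(1)[of 1] *(1)[of 2] by (simp, simp add: field_simps)
  show "lam + 1/3 = 0"
    using coeffs by algebra
  have e: "\<beta> * (v $ Inr 2)\<^sup>2 = 2 * (\<beta> * (v $ Inr 1)\<^sup>2)"
    using coeffs by algebra
  show d: "\<beta> * v $ Inr 1 * v $ Inr 2 = 0"
    using *(2)[of 1] by simp
  \<comment> \<open>The product of the two square coefficients is the square of the mixed one, which
    is zero.\<close>
  have "2 * (\<beta> * (v $ Inr 1)\<^sup>2)\<^sup>2 = (\<beta> * (v $ Inr 1)\<^sup>2) * (\<beta> * (v $ Inr 2)\<^sup>2)"
    unfolding e by (simp add: power2_eq_square)
  also have "\<dots> = (\<beta> * v $ Inr 1 * v $ Inr 2)\<^sup>2"
    by (simp add: power2_eq_square mult_ac)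
  finally show 1: "\<beta> * (v $ Inr 1)\<^sup>2 = 0"
    unfolding d by simp
  show "\<beta> * (v $ Inr 2)\<^sup>2 = 0"
    using e 1 by simp
qed

lemma hyp_gradient_zero:
  assumes "p \<in> flat_hyp_domain"
  shows "partial (Inr a) F p = 0"
proof -
  have "partial (Inr 1) F p = 0" "partial (Inr 2) F p = 0"
    using hyp_gradient[OF assms] hyp_coefficients_vanish by (simp_all add: right_diff_distrib)
  then show ?thesis using exhaust_2[of a] by metis
qed

section \<open>Integration of the potential\<close>

lemma flat_gradient:
  obtains k where "\<And>p. p \<in> flat_hyp_domain \<Longrightarrow> partial (Inl a) F p =
    (\<Sum>b\<in>UNIV. ((if a = b then lam - 1/3 else 0) + \<beta> * v $ Inl a * v $ Inl b) * p $ Inl b) + k"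
proof -
  let ?m = "\<lambda>b. (if a = b then lam - 1/3 else 0) + \<beta> * v $ Inl a * v $ Inl b"
  \<comment> \<open>The subtracted linear function has the same s- and t-derivatives; the x- and
    y-derivatives vanish by \<open>mixed_coefficients_vanish\<close>.\<close>
  let ?h = "\<lambda>p. partial (Inl a) F p - (?m 1 * p $ Inl 1 + ?m 2 * p $ Inl 2)"
  have diff: "?h differentiable (at p)" if "p \<in> flat_hyp_domain" for p
    using that by (intro differentiable_diff diff_partial
      differentiable_add differentiable_mult differentiable_const differentiable_coord)
  have "\<forall>i. partial i ?h p = 0" if p: "p \<in> flat_hyp_domain" for p
    using p unfolding forall_plus_2
    by (simp add: partial_diff partial_add partial_mult diff_partial differentiable_coord
        differentiable_add differentiable_mult partial_coord second_partials mixed_coefficients_vanish)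
  then obtain k where "\<And>p. p \<in> flat_hyp_domain \<Longrightarrow> ?h p = k"
    using partial_zero_imp_constant[OF convex_flat_hyp_domain diff] by blast
  then show ?thesis
    by (intro that[of k]) (simp add: sum_2 algebra_simps)
qed

lemma potential:
  obtains c c1 c3 where "\<And>p. p \<in> flat_hyp_domain \<Longrightarrow> F p =
      1/2 * ((lam - 1/3) + \<beta> * (v $ Inl 1)\<^sup>2) * (p $ Inl 1)\<^sup>2 + 1/2 * ((lam - 1/3)
        + \<beta> * (v $ Inl 2)\<^sup>2) * (p $ Inl 2)\<^sup>2
      + \<beta> * v $ Inl 1 * v $ Inl 2 * p $ Inl 1 * p $ Inl 2 + c1 * p $ Inl 1 + c3 * p $ Inl 2 + c"
proof -
  define A C where "A = 1/2 * ((lam - 1/3) + \<beta> * (v $ Inl 1)\<^sup>2)" and "C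
    = 1/2 * ((lam - 1/3) + \<beta> * (v $ Inl 2)\<^sup>2)"
  let ?B = "\<beta> * v $ Inl 1 * v $ Inl 2"
  obtain c1 where "\<And>p. p \<in> flat_hyp_domain \<Longrightarrow> partial (Inl 1) F p =
      (\<Sum>b\<in>UNIV. ((if 1 = b then lam - 1/3 else 0) + \<beta> * v $ Inl 1 * v $ Inl b) * p $ Inl b) + c1"
    using flat_gradient[of 1] by blast
  then have c1: "partial (Inl 1) F p
    = 2 * A * p $ Inl 1 + ?B * p $ Inl 2 + c1" if "p \<in> flat_hyp_domain" for p
    using that by (simp add: sum_2 A_def power2_eq_square algebra_simps)
  obtain c3 where "\<And>p. p \<in> flat_hyp_domain \<Longrightarrow> partial (Inl 2) F p =
      (\<Sum>b\<in>UNIV. ((if 2 = b then lam - 1/3 else 0) + \<beta> * v $ Inl 2 * v $ Inl b) * p $ Inl b) + c3"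
    using flat_gradient[of 2] by blast
  then have c3: "partial (Inl 2) F p
    = ?B * p $ Inl 1 + 2 * C * p $ Inl 2 + c3" if "p \<in> flat_hyp_domain" for p
    using that by (simp add: sum_2 C_def power2_eq_square algebra_simps)
  \<comment> \<open>Squares are written as products so that \<open>partial_mult\<close>
    applies.\<close>
  let ?q = "\<lambda>p. A * (p $ Inl 1 * p $ Inl 1) + C * (p $ Inl 2 * p $ Inl 2)
      + ?B * (p $ Inl 1 * p $ Inl 2) + c1 * p $ Inl 1 + c3 * p $ Inl 2"
  let ?h = "\<lambda>p. F p - ?q p"
  note intros = differentiable_diff differentiable_add differentiable_mult differentiable_const
    differentiable_coord smooth_on_differentiable[OF smooth]
  have diff: "?h differentiable (at p)" if "p \<in> flat_hyp_domain" for p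
    using that by (intro intros)
  have "\<forall>i. partial i ?h p = 0" if p: "p \<in> flat_hyp_domain" for p
    using p unfolding forall_plus_2
    by (simp add: partial_diff partial_add partial_mult intros partial_coord c1 c3 hyp_gradient_zero)
  then obtain c where "\<And>p. p \<in> flat_hyp_domain \<Longrightarrow> ?h p = c"
    using partial_zero_imp_constant[OF convex_flat_hyp_domain diff] by blast
  then show ?thesis
    by (intro that[of c1 c3 c]) (simp add: A_def C_def power2_eq_square algebra_simps)
qed

end

theorem theorem4p2:
  fixes \<beta> lam P1 P2 P3 P4 :: real
    and F :: "real ^ (2 + 2) \<Rightarrow> real"
    and g :: "(2 + 2) metric"
    and P :: "real ^ (2 + 2) \<Rightarrow> real ^ (2 + 2)"
  defines "g \<equiv> product_metric flat_metric hyperbolic_metric"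
    and "P \<equiv> (\<lambda>_. vec_join (vector [P1, P2]) (vector [P3, P4]))"
  assumes "gradient_omega_bach_soliton (product_domain UNIV upper_half_plane) g \<beta>
             (dual_form g P) F lam"
  shows "\<exists>c c1 c3. \<forall>s t x y. 0 < y \<longrightarrow>
    F (vec_join (vector [s, t]) (vector [x, y])) =
      1/2 * ((lam - 1/3) + \<beta> * P1\<^sup>2) * s\<^sup>2 + 1/2 * ((lam - 1/3) + \<beta> * P2\<^sup>2) * t\<^sup>2
      + \<beta> * P1 * P2 * s * t + c1 * s + c3 * t
      - (lam + 1/3) * ln y - 1/2 * \<beta> * P3\<^sup>2 * y\<^sup>2 + c"
proof -
  let ?v = "vec_join (vector [P1, P2]) (vector [P3, P4]) :: real ^ (2 + 2)"
  have [simp]: "(vec_join u w :: real ^ (2 + 2)) $ Inl a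
    = u $ a" "(vec_join u w :: real ^ (2 + 2)) $ Inr a = w $ a" for u w a
    by (simp_all add: vec_join_def)
  interpret flat_hyp_soliton \<beta> lam ?v F
    using assms by unfold_locales simp
  have zero: "lam + 1/3 = 0" "\<beta> * P3\<^sup>2 = 0"
    using hyp_coefficients_vanish(1,2) by simp_all
  obtain c c1 c3 where eq: "\<And>p. p \<in> flat_hyp_domain \<Longrightarrow> F p =
      1/2 * ((lam - 1/3) + \<beta> * (?v $ Inl 1)\<^sup>2) * (p $ Inl 1)\<^sup>2 + 1/2 * ((lam - 1/3)
        + \<beta> * (?v $ Inl 2)\<^sup>2) * (p $ Inl 2)\<^sup>2
      + \<beta> * ?v $ Inl 1 * ?v $ Inl 2 * p $ Inl 1 * p $ Inl 2 + c1 * p $ Inl 1 + c3 * p $ Inl 2 + c"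
    using potential by blast
  \<comment> \<open>The integrability conditions make the coefficients of both terms in y zero, so
    the formula reduces to the polynomial from \<open>potential\<close>.\<close>
  have log_zero: "(lam + 1/3) * ln y = 0" and square_zero: "1/2 * \<beta> * P3\<^sup>2 * y\<^sup>2 = 0" for y
    using zero by simp_all
  show ?thesis
    unfolding log_zero square_zero
    by (intro exI[of _ c] exI[of _ c1] exI[of _ c3] allI impI, subst eq)
      (simp_all add: mem_flat_hyp_domain)
qed

end
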